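(* Let $n\ge 1$ and let $H$ be a Hadamard matrix of order $4n$. Then $H$, or some Hadamard matrix $H'$ equivalent to $H$, is contained in $\mathcal{E}_{4n}(2n)$ or in $\mathcal{O}_{4n}(2n)$; that is, either every row of the matrix lies in the union of the basic sets belonging to $\mathcal{E}_{4n}(2n)$, or every row of the matrix lies in the union of the basic sets belonging to $\mathcal{O}_{4n}(2n)$.
   Context: $\mathbb{Z}_2=\{+,-\}=\{1,-1\}$ under multiplication, and $\mathbb{Z}_2^m$ is the group of $\pm1$ sequences of length $m$ under componentwise multiplication. For $X\in\mathbb{Z}_2^m$, $\omega(X)$ (Hamming weight) is the number of entries of $X$ equal to $+$. For $0\le k\le m$, $\mathcal{G}_m(k)=\{X\in\mathbb{Z}_2^m:\omega(X)=k\}$; these are called basic sets, and $\mathfrak{S}(\mathbb{Z}_2^m,S_m)=\{\mathcal{G}_m(0),\dots,\mathcal{G}_m(m)\}$. For $A,B\subseteq\mathbb{Z}_2^m$, $AB=\{XY:X\in A,Y\in B\}$ and $A^2=AA$. A set $\mathfrak{S}'\subset\mathfrak{S}(\mathbb{Z}_2^m,S_m)$ of basic sets is a $\mathcal{G}_m(a)$-complete $S$-set if: (1) $\mathcal{G}_m(i)\mathcal{G}_m(j)\supset\mathcal{G}_m(a)$ for all $\mathcal{G}_m(i),\mathcal{G}_m(j)\in\mathfrak{S}'$ (including $i=j$); (2) there is no $\mathcal{G}_m(b)\in\mathfrak{S}(\mathbb{Z}_2^m,S_m)\setminus\mathfrak{S}'$ such that $\mathcal{G}_m(b)^2\supset\mathcal{G}_m(a)$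 and $\mathcal{G}_m(b)\mathcal{G}_m(k)\supset\mathcal{G}_m(a)$ for all $\mathcal{G}_m(k)\in\mathfrak{S}'$. $\mathcal{E}_m(a)$ denotes the $\mathcal{G}_m(a)$-complete $S$-set all of whose basic sets $\mathcal{G}_m(k)$ have $k$ even, and $\mathcal{O}_m(a)$ the one all of whose basic sets have $k$ odd. A Hadamard matrix of order $N$ is an $N\times N$ matrix $H$ with entries $\pm1$ and $HH^t=NI_N$; its rows are regarded as elements of $\mathbb{Z}_2^N$. Two Hadamard matrices are equivalent if one is obtained from the other by a finite sequence of permutations of rows or of columns and multiplications of a row or of a column by $-1$. *)

theory Defs
  imports
    "Jordan_Normal_Form.Determinant"
    "Jordan_Normal_Form.Column_Operations"
begin

(* Elements of the group of +1/-1 sequences of length m are integer vectors with entries 1, -1. *)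

definition sign_vecs :: "nat \<Rightarrow> int vec set" where
  "sign_vecs m = {X \<in> carrier_vec m. \<forall>i<m. X $ i = 1 \<or> X $ i = -1}"

definition sign_mult :: "int vec \<Rightarrow> int vec \<Rightarrow> int vec" where
  "sign_mult X Y = vec (dim_vec X) (\<lambda>i. X $ i * Y $ i)"

definition set_mult :: "int vec set \<Rightarrow> int vec set \<Rightarrow> int vec set" where
  "set_mult A B = {sign_mult X Y | X Y. X \<in> A \<and> Y \<in> B}"

(* The weight counts the entries +1, not the entries -1. *)
definition hamming_weight :: "int vec \<Rightarrow> nat" where
  "hamming_weight X = card {i. i < dim_vec X \<and> X $ i = 1}"

definition basic_set :: "nat \<Rightarrow> nat \<Rightarrow> int vec set" where
  "basic_set m k = {X \<in> sign_vecs m. hamming_weight X = k}"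

definition basic_sets :: "nat \<Rightarrow> int vec set set" where
  "basic_sets m = {basic_set m k | k. k \<le> m}"

definition complete_S_set :: "nat \<Rightarrow> nat \<Rightarrow> int vec set set \<Rightarrow> bool" where
  "complete_S_set m a \<SS> \<longleftrightarrow>
     \<SS> \<subseteq> basic_sets m \<and>
     (\<forall>A\<in>\<SS>. \<forall>B\<in>\<SS>. basic_set m a \<subseteq> set_mult A B) \<and>
     \<not> (\<exists>B \<in> basic_sets m - \<SS>.
          basic_set m a \<subseteq> set_mult B B \<and>
          (\<forall>A\<in>\<SS>. basic_set m a \<subseteq> set_mult B A))"

(* The descriptions below denote only if exactly one complete S-set has the required parity.
   This is the case for m = 4n, a = 2n, n \<ge> 1. The range k \<le> m matters: for k > m the set
   basic_set m k is empty, hence the same set for both parities of k. *)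
definition even_complete :: "nat \<Rightarrow> nat \<Rightarrow> int vec set set" where
  "even_complete m a =
     (THE \<SS>. complete_S_set m a \<SS> \<and> (\<forall>k\<le>m. basic_set m k \<in> \<SS> \<longrightarrow> even k))"

definition odd_complete :: "nat \<Rightarrow> nat \<Rightarrow> int vec set set" where
  "odd_complete m a =
     (THE \<SS>. complete_S_set m a \<SS> \<and> (\<forall>k\<le>m. basic_set m k \<in> \<SS> \<longrightarrow> odd k))"

definition hadamard_matrix :: "nat \<Rightarrow> int mat \<Rightarrow> bool" where
  "hadamard_matrix N H \<longleftrightarrow>
     H \<in> carrier_mat N N \<and>
     (\<forall>i<N. \<forall>j<N. H $$ (i, j) = 1 \<or> H $$ (i, j) = -1) \<and>
     H * H\<^sup>T = of_nat N \<cdot>\<^sub>m 1\<^sub>m N"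

inductive hadamard_step :: "int mat \<Rightarrow> int mat \<Rightarrow> bool" where
  permute_rows: "p permutes {0..<dim_row A} \<Longrightarrow>
     hadamard_step A (mat (dim_row A) (dim_col A) (\<lambda>(i, j). A $$ (p i, j)))"
| permute_cols: "p permutes {0..<dim_col A} \<Longrightarrow>
     hadamard_step A (mat (dim_row A) (dim_col A) (\<lambda>(i, j). A $$ (i, p j)))"
| negate_row: "k < dim_row A \<Longrightarrow> hadamard_step A (multrow k (-1) A)"
| negate_col: "k < dim_col A \<Longrightarrow> hadamard_step A (multcol k (-1) A)"

definition hadamard_equivalent :: "int mat \<Rightarrow> int mat \<Rightarrow> bool" where
  "hadamard_equivalent = hadamard_step\<^sup>*\<^sup>*"

end

(* Scale the columns of H so that its first row becomes n entries -1 followed by 3n entries +1.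
   Orthogonality to this row forces any other row with p entries +1 among its first n positions
   to have weight n + 2p. So all weights lie between n and 3n and have the parity of n, which
   are exactly the weights occurring in the even, respectively odd, complete S-set. *)
theory Submission
  imports Defs
begin

subsection \<open>Sign vectors and their weights\<close>

text \<open>Sign vectors are traded for their sets of + positions: weights become cardinalities, and
  factors can be built by choosing subsets.\<close>

definition plus_set :: "int vec \<Rightarrow> nat set" where
  "plus_set X = {i. i < dim_vec X \<and> X $ i = 1}"

definition sign_vec_of :: "nat \<Rightarrow> nat set \<Rightarrow> int vec" where
  "sign_vec_of m A = vec m (\<lambda>i. if i \<in> A then 1 else -1)"

lemma hamming_weight_card: "hamming_weight X = card (plus_set X)"
  by (simp add: hamming_weight_def plus_set_def)

lemma plus_set_subset: "X \<in> sign_vecs m \<Longrightarrow> plus_set X \<subseteq> {..<m}"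
  by (auto simp: plus_set_def sign_vecs_def)

lemma sign_vec_of_in: "sign_vec_of m A \<in> sign_vecs m"
  by (auto simp: sign_vec_of_def sign_vecs_def)

lemma plus_set_sign_vec_of: "A \<subseteq> {..<m} \<Longrightarrow> plus_set (sign_vec_of m A) = A"
  by (auto simp: sign_vec_of_def plus_set_def split: if_splits)

lemma sign_vec_of_basic_set: "A \<subseteq> {..<m} \<Longrightarrow> sign_vec_of m A \<in> basic_set m (card A)"
  by (simp add: basic_set_def sign_vec_of_in hamming_weight_card plus_set_sign_vec_of)

lemma basic_set_nonempty: "k \<le> m \<Longrightarrow> basic_set m k \<noteq> {}"
  using sign_vec_of_basic_set[of "{..<k}" m] by auto

lemma basic_set_inject: "k \<le> m \<Longrightarrow> basic_set m k = basic_set m l \<longleftrightarrow> k = l"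
  using basic_set_nonempty[of k m] by (auto simp: basic_set_def)

lemma sign_mult_in: "X \<in> sign_vecs m \<Longrightarrow> Y \<in> sign_vecs m \<Longrightarrow> sign_mult X Y \<in> sign_vecs m"
  by (fastforce simp: sign_mult_def sign_vecs_def)

text \<open>Every sign vector is its own inverse, so once X is chosen, Z = XY is solved by Y =
  XZ.\<close>

lemma sign_mult_cancel:
  assumes "X \<in> sign_vecs m" "Z \<in> sign_vecs m"
  shows "sign_mult X (sign_mult X Z) = Z"
proof (rule eq_vecI)
  fix i assume "i < dim_vec Z"
  then show "sign_mult X (sign_mult X Z) $ i = Z $ i"
    using assms by (fastforce simp: sign_mult_def sign_vecs_def)
qed (use assms in \<open>auto simp: sign_mult_def sign_vecs_def\<close>)

text \<open>The product is + exactly where the factors agree: on the intersection of the plus sets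
  and off their union. Inclusion-exclusion then gives the count. The additive form avoids
  subtraction of naturals.\<close>

lemma hamming_weight_sign_mult:
  assumes X: "X \<in> sign_vecs m" and Y: "Y \<in> sign_vecs m"
  shows "hamming_weight (sign_mult X Y) + hamming_weight X + hamming_weight Y
           = m + 2 * card (plus_set X \<inter> plus_set Y)"
proof -
  let ?A = "plus_set X" and ?B = "plus_set Y"
  have sub: "?A \<union> ?B \<subseteq> {..<m}" using plus_set_subset X Y by blast
  then have fin: "finite ?A" "finite ?B" by (auto intro: finite_subset)
  have "plus_set (sign_mult X Y) = ?A \<inter> ?B \<union> ({..<m} - (?A \<union> ?B))"
    using X Y by (fastforce simp: plus_set_def sign_mult_def sign_vecs_def)
  then have "card (plus_set (sign_mult X Y)) = card (?A \<inter> ?B) + card ({..<m} - (?A \<union> ?B))"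
    using fin by (simp, subst card_Un_disjoint) auto
  moreover have "card ({..<m} - (?A \<union> ?B)) + card (?A \<union> ?B) = m"
    using sub card_mono[OF _ sub] fin by (simp add: card_Diff_subset)
  moreover have "card ?A + card ?B = card (?A \<union> ?B) + card (?A \<inter> ?B)"
    using fin by (rule card_Un_Int)
  ultimately show ?thesis by (simp add: hamming_weight_card)
qed

subsection \<open>The complete S-sets of given parity\<close>

text \<open>For Z of weight 2n, it suffices to find X of weight i such that XZ has weight j. Only
  the overlap of the plus sets of X and Z matters; the bounds on i and j leave room for the required
  overlap.\<close>

lemma basic_set_subset_set_mult:
  assumes i: "n \<le> i" "i \<le> 3 * n" and j: "n \<le> j" "j \<le> 3 * n" and par: "even i = even j"
  shows "basic_set (4 * n) (2 * n) \<subseteq> set_mult (basic_set (4 * n) i) (basic_set (4 * n) j)"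
proof
  fix Z assume "Z \<in> basic_set (4 * n) (2 * n)"
  then have Z: "Z \<in> sign_vecs (4 * n)" and wZ: "hamming_weight Z = 2 * n"
    by (auto simp: basic_set_def)
  let ?P = "plus_set Z"
  let ?N = "{..<4 * n} - ?P"
  have P: "?P \<subseteq> {..<4 * n}" "card ?P = 2 * n"
    using plus_set_subset[OF Z] wZ by (auto simp: hamming_weight_card)
  then have N: "card ?N = 2 * n"
    by (simp add: card_Diff_subset finite_subset)
  \<comment> \<open>The weight formula for X and Z reads j + i + 2n = 4n + 2a, where a is the size
    of the overlap; this forces the value of a. Equal parity makes the halving exact.\<close>
  define a where "a = (i + j - 2 * n) div 2"
  have "even (i + j - 2 * n)" using par i j by simp
  then have a: "i + j = 2 * n + 2 * a" using i j by (simp add: a_def)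
  obtain A where A: "A \<subseteq> ?P" "card A = a"
  proof -
    have "a \<le> card ?P" using P a i j by linarith
    then show ?thesis using obtain_subset_with_card_n that by metis
  qed
  obtain B where B: "B \<subseteq> ?N" "card B = i - a"
  proof -
    have "i - a \<le> card ?N" using N a i j by linarith
    then show ?thesis using obtain_subset_with_card_n that by metis
  qed
  have fin: "finite A" "finite B"
    using A B P finite_subset[of _ "{..<4 * n}"] by (meson finite_lessThan subset_trans Diff_subset)+
  define X where "X = sign_vec_of (4 * n) (A \<union> B)"
  have AB: "A \<union> B \<subseteq> {..<4 * n}" using A B P by blast
  \<comment> \<open>Since j - i \<le> 2n, a \<le> i holds, so the truncated difference i - a is
    exact.\<close>
  have "card (A \<union> B) = i"
    using A B fin a j i by (subst card_Un_disjoint) auto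
  then have X: "X \<in> basic_set (4 * n) i"
    using sign_vec_of_basic_set[OF AB] by (simp add: X_def)
  then have X': "X \<in> sign_vecs (4 * n)" "hamming_weight X = i" by (auto simp: basic_set_def)
  have "plus_set X \<inter> ?P = A"
    using A B by (auto simp: X_def plus_set_sign_vec_of[OF AB])
  then have "hamming_weight (sign_mult X Z) = j"
    using hamming_weight_sign_mult[OF X'(1) Z] X'(2) wZ A(2) a by simp
  then have "sign_mult X Z \<in> basic_set (4 * n) j"
    by (simp add: basic_set_def sign_mult_in X' Z)
  then show "Z \<in> set_mult (basic_set (4 * n) i) (basic_set (4 * n) j)"
    using X sign_mult_cancel[OF X'(1) Z] by (force simp: set_mult_def)
qed

text \<open>One factored element of the middle basic set is enough: inserting its weight 2n into the
  weight formula yields the equation. Both necessary conditions below, on parity and on range, come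
  from it.\<close>

lemma set_mult_basic_setE:
  assumes "basic_set (4 * n) (2 * n) \<subseteq> set_mult (basic_set (4 * n) i) (basic_set (4 * n) j)"
  obtains X Y where "X \<in> sign_vecs (4 * n)" "hamming_weight X = i"
    "Y \<in> sign_vecs (4 * n)" "hamming_weight Y = j"
    "i + j = 2 * n + 2 * card (plus_set X \<inter> plus_set Y)"
proof -
  obtain Z where Z: "Z \<in> basic_set (4 * n) (2 * n)"
    using basic_set_nonempty[of "2 * n" "4 * n"] by auto
  with assms obtain X Y where XY: "X \<in> basic_set (4 * n) i" "Y \<in> basic_set (4 * n) j"
      "Z = sign_mult X Y"
    by (auto simp: set_mult_def)
  then have "X \<in> sign_vecs (4 * n)" "Y \<in> sign_vecs (4 * n)"
    "hamming_weight X = i" "hamming_weight Y = j" "hamming_weight (sign_mult X Y) = 2 * n"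
    using Z by (auto simp: basic_set_def)
  with hamming_weight_sign_mult[of X "4 * n" Y] show ?thesis by (intro that[of X Y]) auto
qed

lemma set_mult_basic_set_parity:
  assumes "basic_set (4 * n) (2 * n) \<subseteq> set_mult (basic_set (4 * n) i) (basic_set (4 * n) j)"
  shows "even i = even j"
proof -
  have "even (i + j)" using assms by (elim set_mult_basic_setE) simp
  then show ?thesis by simp
qed

text \<open>With t the overlap of the two plus sets, i = n + t gives the lower bound. Their union
  has 2i - t = i + n elements among 4n positions, which gives the upper bound.\<close>

lemma set_mult_basic_set_self:
  assumes "basic_set (4 * n) (2 * n) \<subseteq> set_mult (basic_set (4 * n) i) (basic_set (4 * n) i)"
  shows "n \<le> i" "i \<le> 3 * n"
proof -
  obtain X Y where X: "X \<in> sign_vecs (4 * n)" "hamming_weight X = i"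
    and Y: "Y \<in> sign_vecs (4 * n)" "hamming_weight Y = i"
    and t: "i + i = 2 * n + 2 * card (plus_set X \<inter> plus_set Y)"
    using assms by (rule set_mult_basic_setE)
  have sub: "plus_set X \<union> plus_set Y \<subseteq> {..<4 * n}"
    using plus_set_subset X(1) Y(1) by blast
  then have "card (plus_set X \<union> plus_set Y) \<le> 4 * n"
    using card_mono[OF _ sub] by simp
  moreover have "card (plus_set X) + card (plus_set Y)
      = card (plus_set X \<union> plus_set Y) + card (plus_set X \<inter> plus_set Y)"
    using sub by (intro card_Un_Int) (auto intro: finite_subset)
  ultimately show "i \<le> 3 * n" using t X Y by (simp add: hamming_weight_card)
  show "n \<le> i" using t by simp
qed

section \<open>Explicit form of the complete S-sets, both parities at once\<close>

definition parity_sets :: "nat \<Rightarrow> bool \<Rightarrow> int vec set set" where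
  "parity_sets n b = {basic_set (4 * n) k | k. n \<le> k \<and> k \<le> 3 * n \<and> even k = b}"

lemma parity_sets_mem:
  "k \<le> 4 * n \<Longrightarrow> basic_set (4 * n) k \<in> parity_sets n b \<longleftrightarrow> n \<le> k \<and> k \<le> 3 * n \<and> even k = b"
  by (auto simp: parity_sets_def basic_set_inject)

text \<open>Either n or n + 1 has the wanted parity, and n + 1 \<le> 3n. Such a member is what fixes
  the parity of a competing basic set in the maximality argument.\<close>

lemma parity_sets_nonempty:
  fixes n :: nat
  assumes "n \<ge> 1"
  obtains k where "n \<le> k" "k \<le> 3 * n" "even k = b"
proof (cases "even n = b")
  case True
  then show ?thesis using that[of n] by simp
next
  case False
  then show ?thesis using that[of "n + 1"] assms by simp
qed

text \<open>Maximality: the product of a further basic set with a member fixes its parity, and its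
  square confines its weight to the range from n to 3n. It would therefore already be a
  member.\<close>

lemma complete_S_set_parity_sets:
  assumes "n \<ge> 1"
  shows "complete_S_set (4 * n) (2 * n) (parity_sets n b)"
  unfolding complete_S_set_def
proof (intro conjI ballI notI)
  show "parity_sets n b \<subseteq> basic_sets (4 * n)"
    by (auto simp: parity_sets_def basic_sets_def)
  show "basic_set (4 * n) (2 * n) \<subseteq> set_mult A B"
    if "A \<in> parity_sets n b" "B \<in> parity_sets n b" for A B
    using that basic_set_subset_set_mult by (auto simp: parity_sets_def)
  assume "\<exists>B \<in> basic_sets (4 * n) - parity_sets n b.
    basic_set (4 * n) (2 * n) \<subseteq> set_mult B B \<and>
    (\<forall>A\<in>parity_sets n b. basic_set (4 * n) (2 * n) \<subseteq> set_mult B A)"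
  then obtain l where l: "basic_set (4 * n) l \<notin> parity_sets n b"
    "basic_set (4 * n) (2 * n) \<subseteq> set_mult (basic_set (4 * n) l) (basic_set (4 * n) l)"
    "\<And>A. A \<in> parity_sets n b \<Longrightarrow> basic_set (4 * n) (2 * n) \<subseteq> set_mult (basic_set (4 * n) l) A"
    by (auto simp: basic_sets_def)
  obtain k where k: "n \<le> k" "k \<le> 3 * n" "even k = b" using parity_sets_nonempty assms .
  then have "even l = b"
    using set_mult_basic_set_parity[OF l(3)] by (auto simp: parity_sets_def)
  then show False using l(1) set_mult_basic_set_self[OF l(2)] by (auto simp: parity_sets_def)
qed

text \<open>The square condition and the parity give the inclusion in
  \<open>parity_sets n b\<close>. Conversely, members of \<open>parity_sets n b\<close> are
  compatible with one another, hence with the whole of its subset \<SS>, so maximality of \<SS>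
  admits no missing one.\<close>

lemma complete_S_set_unique:
  assumes S: "complete_S_set (4 * n) (2 * n) \<SS>"
    and par: "\<forall>k\<le>4 * n. basic_set (4 * n) k \<in> \<SS> \<longrightarrow> even k = b"
  shows "\<SS> = parity_sets n b"
proof
  show sub: "\<SS> \<subseteq> parity_sets n b"
  proof
    fix A assume A: "A \<in> \<SS>"
    with S obtain k where k: "k \<le> 4 * n" "A = basic_set (4 * n) k"
      by (auto simp: complete_S_set_def basic_sets_def)
    moreover have "basic_set (4 * n) (2 * n) \<subseteq> set_mult A A"
      using S A by (auto simp: complete_S_set_def)
    ultimately show "A \<in> parity_sets n b"
      using set_mult_basic_set_self[of n k] par A by (auto simp: parity_sets_def)
  qed
  show "parity_sets n b \<subseteq> \<SS>"
  proof
    fix B assume B: "B \<in> parity_sets n b"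
    have prod: "basic_set (4 * n) (2 * n) \<subseteq> set_mult B A" if "A \<in> parity_sets n b" for A
      using that B basic_set_subset_set_mult by (auto simp: parity_sets_def)
    have "B \<in> basic_sets (4 * n)" using B by (auto simp: parity_sets_def basic_sets_def)
    then show "B \<in> \<SS>" using S prod B sub unfolding complete_S_set_def by blast
  qed
qed

lemma even_complete_eq:
  assumes "n \<ge> 1"
  shows "even_complete (4 * n) (2 * n) = parity_sets n True"
  unfolding even_complete_def
proof (rule the_equality)
  show "complete_S_set (4 * n) (2 * n) (parity_sets n True) \<and>
    (\<forall>k\<le>4 * n. basic_set (4 * n) k \<in> parity_sets n True \<longrightarrow> even k)"
    using complete_S_set_parity_sets[OF assms] by (simp add: parity_sets_mem)
qed (simp add: complete_S_set_unique)

lemma odd_complete_eq: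
  assumes "n \<ge> 1"
  shows "odd_complete (4 * n) (2 * n) = parity_sets n False"
  unfolding odd_complete_def
proof (rule the_equality)
  show "complete_S_set (4 * n) (2 * n) (parity_sets n False) \<and>
    (\<forall>k\<le>4 * n. basic_set (4 * n) k \<in> parity_sets n False \<longrightarrow> odd k)"
    using complete_S_set_parity_sets[OF assms] by (simp add: parity_sets_mem)
qed (simp add: complete_S_set_unique)

subsection \<open>Scaling the columns of a Hadamard matrix\<close>

text \<open>This is right multiplication by the diagonal matrix with entries
  \<open>s j\<close>.\<close>

definition scale_cols :: "(nat \<Rightarrow> int) \<Rightarrow> int mat \<Rightarrow> int mat" where
  "scale_cols s A = mat (dim_row A) (dim_col A) (\<lambda>(i, j). A $$ (i, j) * s j)"

lemma hadamard_equivalent_scale_cols: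
  assumes s: "\<And>j. j < dim_col A \<Longrightarrow> s j = 1 \<or> s j = -1"
  shows "hadamard_equivalent A (scale_cols s A)"
proof -
  \<comment> \<open>The columns are treated one by one: the first k are already scaled, and the
    default factor 1 leaves the others alone. Each further column needs at most one
    negation.\<close>
  have "hadamard_equivalent A (scale_cols (\<lambda>j. if j < k then s j else 1) A)"
    if "k \<le> dim_col A" for k
    using that
  proof (induction k)
    case 0
    have "scale_cols (\<lambda>j. if j < 0 then s j else 1) A = A"
      by (rule eq_matI) (auto simp: scale_cols_def)
    then show ?case by (simp add: hadamard_equivalent_def)
  next
    case (Suc k)
    let ?B = "\<lambda>k. scale_cols (\<lambda>j. if j < k then s j else 1) A"
    have IH: "hadamard_equivalent A (?B k)" using Suc by simp
    show ?case
    proof (cases "s k = 1")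
      case True
      then have "?B (Suc k) = ?B k"
        by (intro eq_matI) (auto simp: scale_cols_def less_Suc_eq)
      then show ?thesis using IH by simp
    next
      case False
      then have "s k = -1" using s[of k] Suc.prems by auto
      then have "?B (Suc k) = multcol k (-1) (?B k)"
        by (intro eq_matI) (auto simp: scale_cols_def less_Suc_eq mat_multcol_def)
      moreover have "hadamard_step (?B k) (multcol k (-1) (?B k))"
        using Suc.prems by (intro negate_col) (simp add: scale_cols_def)
      ultimately show ?thesis using IH by (simp add: hadamard_equivalent_def)
    qed
  qed
  from this[of "dim_col A"] have "hadamard_equivalent A
      (scale_cols (\<lambda>j. if j < dim_col A then s j else 1) A)" by simp
  also have "scale_cols (\<lambda>j. if j < dim_col A then s j else 1) A = scale_cols s A"
    by (rule eq_matI) (auto simp: scale_cols_def)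
  finally show ?thesis .
qed

text \<open>The matrix equation is read entrywise, as inner products of rows, the form in which
  scaling and orthogonality are used.\<close>

lemma hadamard_matrix_iff:
  "hadamard_matrix N H \<longleftrightarrow> H \<in> carrier_mat N N \<and>
     (\<forall>i<N. \<forall>j<N. H $$ (i, j) = 1 \<or> H $$ (i, j) = -1) \<and>
     (\<forall>i<N. \<forall>k<N. (\<Sum>j<N. H $$ (i, j) * H $$ (k, j)) = (if i = k then int N else 0))"
proof (cases "H \<in> carrier_mat N N")
  case True
  have lhs: "(H * H\<^sup>T) $$ (i, k) = (\<Sum>j<N. H $$ (i, j) * H $$ (k, j))"
    if "i < N" "k < N" for i k
    using that True by (simp add: scalar_prod_def atLeast0LessThan)
  have rhs: "(of_nat N \<cdot>\<^sub>m 1\<^sub>m N) $$ (i, k) = (if i = k then int N else 0)"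
    if "i < N" "k < N" for i k
    using that by simp
  have "H * H\<^sup>T = of_nat N \<cdot>\<^sub>m 1\<^sub>m N \<longleftrightarrow>
      (\<forall>i<N. \<forall>k<N. (\<Sum>j<N. H $$ (i, j) * H $$ (k, j)) = (if i = k then int N else 0))"
    (is "?L = ?R \<longleftrightarrow> ?sums")
  proof
    assume eq: "?L = ?R"
    show ?sums
    proof (intro allI impI)
      fix i k assume "i < N" "k < N"
      then show "(\<Sum>j<N. H $$ (i, j) * H $$ (k, j)) = (if i = k then int N else 0)"
        by (simp only: eq rhs flip: lhs)
    qed
  next
    assume ?sums
    show "?L = ?R"
    proof (rule eq_matI)
      fix i k assume "i < dim_row ?R" "k < dim_col ?R"
      then have "i < N" "k < N" by simp_all
      with \<open>?sums\<close> show "?L $$ (i, k) = ?R $$ (i, k)"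
        by (simp only: lhs rhs)
    qed (use True in auto)
  qed
  then show ?thesis using True by (simp only: hadamard_matrix_def)
qed (simp add: hadamard_matrix_def)

text \<open>In an inner product of two rows the factor of column j occurs squared, hence as
  1.\<close>

lemma hadamard_matrix_scale_cols:
  assumes H: "hadamard_matrix N H" and s: "\<And>j. j < N \<Longrightarrow> s j = 1 \<or> s j = -1"
  shows "hadamard_matrix N (scale_cols s H)"
  unfolding hadamard_matrix_iff
proof (intro conjI allI impI)
  have dim: "dim_row H = N" "dim_col H = N" using H by (auto simp: hadamard_matrix_def)
  then show "scale_cols s H \<in> carrier_mat N N" by (auto simp: scale_cols_def)
  show "scale_cols s H $$ (i, j) = 1 \<or> scale_cols s H $$ (i, j) = -1" if "i < N" "j < N" for i j
  proof -
    have "H $$ (i, j) = 1 \<or> H $$ (i, j) = -1"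
      using H that by (auto simp: hadamard_matrix_def)
    then show ?thesis using s[of j] that dim by (auto simp: scale_cols_def)
  qed
  fix i k assume ik: "i < N" "k < N"
  have "(\<Sum>j<N. scale_cols s H $$ (i, j) * scale_cols s H $$ (k, j))
      = (\<Sum>j<N. H $$ (i, j) * H $$ (k, j))"
  proof (rule sum.cong)
    fix j assume "j \<in> {..<N}"
    then show "scale_cols s H $$ (i, j) * scale_cols s H $$ (k, j) = H $$ (i, j) * H $$ (k, j)"
      using s[of j] ik dim by (auto simp: scale_cols_def)
  qed simp
  then show "(\<Sum>j<N. scale_cols s H $$ (i, j) * scale_cols s H $$ (k, j))
      = (if i = k then int N else 0)"
    using H ik by (simp add: hadamard_matrix_iff)
qed

section \<open>Row weights forced by a normalised first row\<close>

lemma sum_signs: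
  fixes f :: "nat \<Rightarrow> int"
  assumes "finite I" "\<And>j. j \<in> I \<Longrightarrow> f j = 1 \<or> f j = -1"
  shows "(\<Sum>j\<in>I. f j) = 2 * int (card {j \<in> I. f j = 1}) - int (card I)"
proof -
  have "(\<Sum>j\<in>I. f j) = (\<Sum>j\<in>I. 2 * of_bool (f j = 1) - 1)"
    using assms(2) by (intro sum.cong) auto
  also have "\<dots> = 2 * int (card {j \<in> I. f j = 1}) - int (card I)"
    using assms(1) by (simp add: sum_subtractf flip: sum_distrib_left)
      (simp add: of_bool_def sum.If_cases Int_def)
  finally show ?thesis .
qed

text \<open>For a later row, orthogonality to the first says that its first n entries and its last
  3n entries have equal sums. With p and q entries +1 there, 2p - n = 2q - 3n, so q = p + n and the
  weight is n + 2p.\<close>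

lemma hadamard_row_weight:
  assumes H: "hadamard_matrix (4 * n) H" and i: "i < 4 * n"
    and first: "\<And>j. j < 4 * n \<Longrightarrow> H $$ (0, j) = (if j < n then -1 else 1)"
  obtains p where "p \<le> n" "hamming_weight (row H i) = n + 2 * p"
proof -
  let ?f = "\<lambda>j. H $$ (i, j)"
  let ?P = "{j \<in> {..<n}. ?f j = 1}" and ?Q = "{j \<in> {n..<4 * n}. ?f j = 1}"
  have sgn: "?f j = 1 \<or> ?f j = -1" if "j < 4 * n" for j
    using that H i by (auto simp: hadamard_matrix_def)
  have dim: "dim_row H = 4 * n" "dim_col H = 4 * n" using H by (auto simp: hadamard_matrix_def)
  have "plus_set (row H i) = ?P \<union> ?Q"
    using i dim by (auto simp: plus_set_def)
  moreover have "card (?P \<union> ?Q) = card ?P + card ?Q"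
    by (rule card_Un_disjoint) auto
  ultimately have w: "hamming_weight (row H i) = card ?P + card ?Q"
    by (simp only: hamming_weight_card)
  have P: "card ?P \<le> n" using card_mono[of "{..<n}" ?P] by auto
  show ?thesis
  proof (cases "i = 0")
    case True
    then have "?P = {}" "?Q = {n..<4 * n}" using first by (auto split: if_splits)
    \<comment> \<open>The first row has weight 3n, so the witness is n and not
      \<open>card ?P\<close>, which is 0 here.\<close>
    then have "hamming_weight (row H i) = n + 2 * n" using w by simp
    then show ?thesis using that[of n] by simp
  next
    case False
    have "0 = (\<Sum>j<4 * n. ?f j * H $$ (0, j))"
      using H i False by (simp add: hadamard_matrix_iff)
    also have "\<dots> = (\<Sum>j<n. ?f j * H $$ (0, j)) + (\<Sum>j=n..<4 * n. ?f j * H $$ (0, j))"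
      by (simp add: sum.atLeastLessThan_concat flip: atLeast0LessThan)
    also have "\<dots> = (\<Sum>j=n..<4 * n. ?f j) - (\<Sum>j<n. ?f j)"
      by (simp add: first sum_negf)
    also have "\<dots> = (2 * int (card ?Q) - 3 * int n) - (2 * int (card ?P) - int n)"
      using sum_signs[of "{n..<4 * n}" ?f] sum_signs[of "{..<n}" ?f] sgn by simp
    finally have "card ?Q = card ?P + n" by linarith
    then show ?thesis using that[of "card ?P"] P w by simp
  qed
qed

theorem theorem13:
  fixes n :: nat and H :: "int mat"
  assumes "n \<ge> 1"
    and "hadamard_matrix (4 * n) H"
  shows "\<exists>H'. hadamard_matrix (4 * n) H' \<and> hadamard_equivalent H H' \<and>
           (set (rows H') \<subseteq> \<Union> (even_complete (4 * n) (2 * n)) \<or>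
            set (rows H') \<subseteq> \<Union> (odd_complete (4 * n) (2 * n)))"
proof -
  \<comment> \<open>As \<open>H $$ (0, j)\<close> squares to 1, this factor turns it into the
    prescribed sign.\<close>
  define s where "s j = H $$ (0, j) * (if j < n then -1 else 1)" for j
  have dim: "dim_row H = 4 * n" "dim_col H = 4 * n"
    using assms by (auto simp: hadamard_matrix_def)
  have sgn0: "H $$ (0, j) = 1 \<or> H $$ (0, j) = -1" if "j < 4 * n" for j
    using assms that by (auto simp: hadamard_matrix_def)
  then have s: "s j = 1 \<or> s j = -1" if "j < 4 * n" for j
    using that by (fastforce simp: s_def)
  let ?H = "scale_cols s H"
  have had: "hadamard_matrix (4 * n) ?H"
    using assms(2) s by (rule hadamard_matrix_scale_cols)
  have equiv: "hadamard_equivalent H ?H"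
    by (rule hadamard_equivalent_scale_cols) (simp add: dim s)
  have first: "?H $$ (0, j) = (if j < n then -1 else 1)" if "j < 4 * n" for j
    using sgn0[OF that] that dim assms(1) by (auto simp: scale_cols_def s_def)
  \<comment> \<open>All weights n + 2p share the parity of n, so this parity alone selects the even
    or the odd alternative for every row.\<close>
  have "set (rows ?H) \<subseteq> \<Union> (parity_sets n (even n))"
  proof
    fix X assume "X \<in> set (rows ?H)"
    then obtain i where i: "i < 4 * n" "X = row ?H i"
      by (auto simp: rows_def scale_cols_def dim)
    obtain p where p: "p \<le> n" "hamming_weight X = n + 2 * p"
      using hadamard_row_weight[OF had i(1) first] i(2) by blast
    have "?H \<in> carrier_mat (4 * n) (4 * n)"
      "\<forall>j<4 * n. ?H $$ (i, j) = 1 \<or> ?H $$ (i, j) = -1"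
      using had i(1) by (auto simp: hadamard_matrix_def)
    then have "X \<in> sign_vecs (4 * n)"
      using i by (simp add: sign_vecs_def)
    then have "X \<in> basic_set (4 * n) (n + 2 * p)" using p by (simp add: basic_set_def)
    moreover have "basic_set (4 * n) (n + 2 * p) \<in> parity_sets n (even n)"
      using p by (auto simp: parity_sets_def)
    ultimately show "X \<in> \<Union> (parity_sets n (even n))" by blast
  qed
  then have "set (rows ?H) \<subseteq> \<Union> (even_complete (4 * n) (2 * n)) \<or>
      set (rows ?H) \<subseteq> \<Union> (odd_complete (4 * n) (2 * n))"
    using even_complete_eq[OF assms(1)] odd_complete_eq[OF assms(1)] by (cases "even n") simp_all
  then show ?thesis using had equiv by blast
qed

end
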